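(* If $\boldsymbol{\xi}$ and $\boldsymbol{a}$ are both uniformly distributed on the commutative quaternion unit sphere $\mathbf{S}^n$, then for $\gamma>0$ with $\gamma\ln n<n$, there exists a constant $c(\gamma)>0$ such that $$\operatorname{Prob}\left\{\operatorname{Re}\left(\boldsymbol{a}^\top\boldsymbol{\xi}\right)\ge\sqrt{\frac{\gamma\ln n}{n}}\right\}\ge\frac{c(\gamma)}{n^{4.5\gamma}\sqrt{\ln n}}.$$
   Context: The commutative quaternions are $\mathbb{H}=\{q_0+q_1\boldsymbol{i}+q_2\boldsymbol{j}+q_3\boldsymbol{k}: q_0,q_1,q_2,q_3\in\mathbb{R}\}$ with the commutative multiplication determined by $\boldsymbol{i}^2=\boldsymbol{k}^2=-1$, $\boldsymbol{j}^2=1$, $\boldsymbol{i}\boldsymbol{j}=\boldsymbol{j}\boldsymbol{i}=\boldsymbol{k}$, $\boldsymbol{j}\boldsymbol{k}=\boldsymbol{k}\boldsymbol{j}=\boldsymbol{i}$, $\boldsymbol{k}\boldsymbol{i}=\boldsymbol{i}\boldsymbol{k}=-\boldsymbol{j}$. The real part is $\operatorname{Re}(q_0+q_1\boldsymbol{i}+q_2\boldsymbol{j}+q_3\boldsymbol{k})=q_0$. A vector $\boldsymbol{x}\in\mathbb{H}^n$ is written $\boldsymbol{x}=x_0+x_1\boldsymbol{i}+x_2\boldsymbol{j}+x_3\boldsymbol{k}$ with $x_0,\dots,x_3\in\mathbb{R}^n$; its norm is $\|\boldsymbol{x}\|=\left(\sum_{i=0}^3 x_i^\top x_i\right)^{1/2}$,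 and $\boldsymbol{x}^\top$ is the transpose (without conjugation). $\mathbf{S}^n=\{\boldsymbol{x}\in\mathbb{H}^n:\|\boldsymbol{x}\|=1\}$. A random vector $\boldsymbol{\xi}\in\mathbb{H}^n$ is uniformly distributed on $\mathbf{S}^n$ if the real vector $(\xi_0^\top,\xi_1^\top,\xi_2^\top,\xi_3^\top)^\top$ is uniformly distributed on the Euclidean unit sphere of $\mathbb{R}^{4n}$. The notation $c(\gamma)$ indicates a constant depending only on $\gamma$.
   Formalization: ξ and a are assumed independent (without this the claim fails: a = −ξ0+ξ1i−ξ2j+ξ3k gives Re(aᵀξ) = −1), and n ≥ 2 (for n = 1 the bound divides by √ln 1 = 0). c(γ) is stated for one type of sample space; it serves all, as the probability depends only on n and γ. *)

theory Defs
  imports "HOL-Probability.Probability"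
begin

section \<open>Commutative quaternions\<close>

datatype cquat = CQuat (cq0: real) (cq1: real) (cq2: real) (cq3: real)

abbreviation cq_Re :: "cquat \<Rightarrow> real" where
  "cq_Re \<equiv> cq0"

lemma cquat_eq_iff: "x = y \<longleftrightarrow> cq0 x = cq0 y \<and> cq1 x = cq1 y \<and> cq2 x = cq2 y \<and> cq3 x = cq3 y"
  by (cases x; cases y) auto

instantiation cquat :: comm_ring_1
begin

definition "0 = CQuat 0 0 0 0"
definition "1 = CQuat 1 0 0 0"
definition "x + y = CQuat (cq0 x + cq0 y) (cq1 x + cq1 y) (cq2 x + cq2 y) (cq3 x + cq3 y)"
definition "- x = CQuat (- cq0 x) (- cq1 x) (- cq2 x) (- cq3 x)"
definition "x - y = CQuat (cq0 x - cq0 y) (cq1 x - cq1 y) (cq2 x - cq2 y) (cq3 x - cq3 y)"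

text \<open>The bilinear extension of the multiplication table of the units, which is
  recovered in \<open>cquat_units\<close> below.\<close>
definition "x * y = CQuat
  (cq0 x * cq0 y - cq1 x * cq1 y + cq2 x * cq2 y - cq3 x * cq3 y)
  (cq0 x * cq1 y + cq1 x * cq0 y + cq2 x * cq3 y + cq3 x * cq2 y)
  (cq0 x * cq2 y + cq2 x * cq0 y - cq1 x * cq3 y - cq3 x * cq1 y)
  (cq0 x * cq3 y + cq3 x * cq0 y + cq1 x * cq2 y + cq2 x * cq1 y)"

instance
  by standard
    (auto simp: cquat_eq_iff zero_cquat_def one_cquat_def plus_cquat_def uminus_cquat_def
      minus_cquat_def times_cquat_def algebra_simps)

end

definition cq_i :: cquat where "cq_i = CQuat 0 1 0 0"
definition cq_j :: cquat where "cq_j = CQuat 0 0 1 0"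
definition cq_k :: cquat where "cq_k = CQuat 0 0 0 1"

lemma cquat_units:
  "cq_i * cq_i = - 1" "cq_k * cq_k = - 1" "cq_j * cq_j = 1"
  "cq_i * cq_j = cq_k" "cq_j * cq_i = cq_k"
  "cq_j * cq_k = cq_i" "cq_k * cq_j = cq_i"
  "cq_k * cq_i = - cq_j" "cq_i * cq_k = - cq_j"
  by (simp_all add: cquat_eq_iff cq_i_def cq_j_def cq_k_def one_cquat_def uminus_cquat_def
      times_cquat_def)

text \<open>The Euclidean structure of \<open>\<real>\<^sup>4\<close>; it supplies the Borel sets of \<^typ>\<open>cquat\<close>.\<close>

instantiation cquat :: real_vector
begin

definition "scaleR r x = CQuat (r * cq0 x) (r * cq1 x) (r * cq2 x) (r * cq3 x)"

instance
  by standard (simp_all add: cquat_eq_iff plus_cquat_def scaleR_cquat_def algebra_simps)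

end

instantiation cquat :: real_inner
begin

definition "inner x y = cq0 x * cq0 y + cq1 x * cq1 y + cq2 x * cq2 y + cq3 x * cq3 y"
definition "norm (x :: cquat) = sqrt (inner x x)"
definition "sgn (x :: cquat) = x /\<^sub>R norm x"
definition "dist (x :: cquat) y = norm (x - y)"
definition "(uniformity :: (cquat \<times> cquat) filter) = (INF e\<in>{0 <..}. principal {(x, y). dist x y < e})"
definition "open (U :: cquat set) \<longleftrightarrow> (\<forall>x\<in>U. eventually (\<lambda>(x', y). x' = x \<longrightarrow> y \<in> U) uniformity)"

instance
proof
  fix x y z :: cquat and r s :: real
  show "0 \<le> inner x x"
    by (simp add: inner_cquat_def)
  show "inner x x = 0 \<longleftrightarrow> x = 0"
    by (simp add: inner_cquat_def cquat_eq_iff zero_cquat_def add_nonneg_eq_0_iff)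
qed (simp_all add: cquat_eq_iff zero_cquat_def plus_cquat_def minus_cquat_def scaleR_cquat_def
      inner_cquat_def norm_cquat_def sgn_cquat_def dist_cquat_def uniformity_cquat_def
      open_cquat_def algebra_simps)

end

instantiation cquat :: euclidean_space
begin

definition "Basis = {1, cq_i, cq_j, cq_k}"

instance
proof
  show "(Basis :: cquat set) \<noteq> {}" "finite (Basis :: cquat set)"
    by (simp_all add: Basis_cquat_def)
  fix u v :: cquat
  show "u \<in> Basis \<Longrightarrow> v \<in> Basis \<Longrightarrow> inner u v = (if u = v then 1 else 0)"
    by (auto simp: Basis_cquat_def inner_cquat_def cquat_eq_iff cq_i_def cq_j_def cq_k_def
        one_cquat_def)
  have "inner v 1 = cq0 v" "inner v cq_i = cq1 v" "inner v cq_j = cq2 v" "inner v cq_k = cq3 v"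
    by (simp_all add: inner_cquat_def cq_i_def cq_j_def cq_k_def one_cquat_def)
  moreover have "v = 0 \<longleftrightarrow> cq0 v = 0 \<and> cq1 v = 0 \<and> cq2 v = 0 \<and> cq3 v = 0"
    by (cases v) (simp add: zero_cquat_def)
  ultimately show "(\<forall>u\<in>Basis. inner v u = 0) \<longleftrightarrow> v = 0"
    by (simp add: Basis_cquat_def)
qed

end

lemma borel_measurable_cq [measurable]:
  "cq0 \<in> borel_measurable borel" "cq1 \<in> borel_measurable borel"
  "cq2 \<in> borel_measurable borel" "cq3 \<in> borel_measurable borel"
proof -
  have *: "(\<lambda>x. inner x u) \<in> borel_measurable borel" for u :: cquat
    by measurable
  show "cq0 \<in> borel_measurable borel"
    using * [of 1] by (simp add: inner_cquat_def one_cquat_def)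
  show "cq1 \<in> borel_measurable borel"
    using * [of cq_i] by (simp add: inner_cquat_def cq_i_def)
  show "cq2 \<in> borel_measurable borel"
    using * [of cq_j] by (simp add: inner_cquat_def cq_j_def)
  show "cq3 \<in> borel_measurable borel"
    using * [of cq_k] by (simp add: inner_cquat_def cq_k_def)
qed


section \<open>Commutative quaternion vectors\<close>

text \<open>
  The constant of the theorem must not depend on \<open>n\<close>, so \<open>n\<close> is quantified inside the formula and
  cannot be a type.  Hence \<open>\<real>\<^sup>m\<close> is \<open>{..<m} \<rightarrow>\<^sub>E UNIV\<close> with the product Borel sets, likewise \<open>\<H>\<^sup>n\<close>,
  and components are indexed from \<open>0\<close>.
\<close>

definition real_vec :: "nat \<Rightarrow> (nat \<Rightarrow> real) measure" where
  "real_vec m = (\<Pi>\<^sub>M i\<in>{..<m}. borel)"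

definition cquat_vec :: "nat \<Rightarrow> (nat \<Rightarrow> cquat) measure" where
  "cquat_vec n = (\<Pi>\<^sub>M i\<in>{..<n}. borel)"

text \<open>\<open>x\<^sup>\<top> y\<close>, without conjugation.\<close>
definition cq_dot :: "nat \<Rightarrow> (nat \<Rightarrow> cquat) \<Rightarrow> (nat \<Rightarrow> cquat) \<Rightarrow> cquat" where
  "cq_dot n x y = (\<Sum>i<n. x i * y i)"

text \<open>The stacked vector \<open>(x\<^sub>0\<^sup>\<top>, x\<^sub>1\<^sup>\<top>, x\<^sub>2\<^sup>\<top>, x\<^sub>3\<^sup>\<top>)\<^sup>\<top>\<close> in \<open>\<real>\<^sup>4\<^sup>n\<close>.\<close>
definition cq_stack :: "nat \<Rightarrow> (nat \<Rightarrow> cquat) \<Rightarrow> nat \<Rightarrow> real" where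
  "cq_stack n x = (\<lambda>m\<in>{..<4 * n}. ([cq0, cq1, cq2, cq3] ! (m div n)) (x (m mod n)))"

definition cq_norm :: "nat \<Rightarrow> (nat \<Rightarrow> cquat) \<Rightarrow> real" where
  "cq_norm n x = sqrt (\<Sum>i<n. (cq0 (x i))\<^sup>2 + (cq1 (x i))\<^sup>2 + (cq2 (x i))\<^sup>2 + (cq3 (x i))\<^sup>2)"

definition cq_sphere :: "nat \<Rightarrow> (nat \<Rightarrow> cquat) set" where
  "cq_sphere n = {x \<in> space (cquat_vec n). cq_norm n x = 1}"


lemma L2_set_cq_stack: "L2_set (cq_stack n x) {..<4 * n} = cq_norm n x"
proof -
  have "(\<Sum>m<4 * n. (cq_stack n x m)\<^sup>2) = (\<Sum>b<4. \<Sum>m=b * n..<b * n + n. (cq_stack n x m)\<^sup>2)"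
    by (rule sum.nat_group [symmetric])
  also have "\<dots> = (\<Sum>b<4. \<Sum>i<n. (([cq0, cq1, cq2, cq3] ! b) (x i))\<^sup>2)"
  proof (rule sum.cong [OF refl])
    fix b :: nat assume "b \<in> {..<4}"
    then have "Suc b * n \<le> 4 * n"
      by (intro mult_le_mono1) auto
    then have "b * n + i < 4 * n" if "i < n" for i
      using that unfolding mult_Suc by linarith
    then show "(\<Sum>m=b * n..<b * n + n. (cq_stack n x m)\<^sup>2)
        = (\<Sum>i<n. (([cq0, cq1, cq2, cq3] ! b) (x i))\<^sup>2)"
      by (subst sum.atLeastLessThan_shift_0)
        (auto simp: cq_stack_def lessThan_atLeast0 div_add1_eq intro!: sum.cong)
  qed
  also have "\<dots> = (\<Sum>i<n. (cq0 (x i))\<^sup>2 + (cq1 (x i))\<^sup>2 + (cq2 (x i))\<^sup>2 + (cq3 (x i))\<^sup>2)"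
    by (simp add: numeral_eq_Suc sum.distrib)
  finally show ?thesis
    by (simp add: L2_set_def cq_norm_def)
qed

lemma measurable_cq_stack [measurable]: "cq_stack n \<in> cquat_vec n \<rightarrow>\<^sub>M real_vec (4 * n)"
  unfolding cq_stack_def cquat_vec_def real_vec_def
proof (rule measurable_restrict)
  fix m assume m: "m \<in> {..<4 * n}"
  then have "n > 0" "m div n < 4"
    by (auto simp: less_mult_imp_div_less intro: gr0I)
  have "[cq0, cq1, cq2, cq3] ! (m div n) \<in> borel_measurable borel"
    using \<open>m div n < 4\<close> nth_mem [of "m div n" "[cq0, cq1, cq2, cq3]"] borel_measurable_cq
    by auto
  moreover have "(\<lambda>x. x (m mod n)) \<in> (\<Pi>\<^sub>M i\<in>{..<n}. borel) \<rightarrow>\<^sub>M (borel :: cquat measure)"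
    using \<open>n > 0\<close> by (intro measurable_component_singleton) auto
  ultimately show "(\<lambda>x. ([cq0, cq1, cq2, cq3] ! (m div n)) (x (m mod n)))
      \<in> borel_measurable (\<Pi>\<^sub>M i\<in>{..<n}. borel)"
    by (rule measurable_compose [rotated])
qed


section \<open>Uniform distribution on the sphere\<close>

definition unit_ball :: "nat \<Rightarrow> (nat \<Rightarrow> real) set" where
  "unit_ball m = {x \<in> space (real_vec m). L2_set x {..<m} \<le> 1}"

text \<open>
  The normalised surface measure of the unit sphere of \<open>\<real>\<^sup>m\<close>, as the radial projection of the
  normalised Lebesgue measure of the unit ball: a Borel set \<open>A\<close> of the sphere has as measure the
  proportion of the ball taken up by the cone over \<open>A\<close>.
\<close>
definition uniform_sphere :: "nat \<Rightarrow> (nat \<Rightarrow> real) measure" where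
  "uniform_sphere m =
    distr (uniform_measure (\<Pi>\<^sub>M i\<in>{..<m}. lborel) (unit_ball m)) (real_vec m)
      (\<lambda>x. \<lambda>i\<in>{..<m}. x i / L2_set x {..<m})"

lemma unit_ball_sets [measurable]: "unit_ball m \<in> sets (\<Pi>\<^sub>M i\<in>{..<m}. lborel)"
proof -
  have "unit_ball m = {x \<in> space (\<Pi>\<^sub>M i\<in>{..<m}. lborel). L2_set x {..<m} \<le> 1}"
    by (simp add: unit_ball_def real_vec_def space_PiM)
  also have "\<dots> \<in> sets (\<Pi>\<^sub>M i\<in>{..<m}. lborel)"
    unfolding L2_set_def by measurable
  finally show ?thesis .
qed

lemma prob_space_uniform_sphere:
  "prob_space (uniform_sphere m)"
proof -
  interpret product_sigma_finite "\<lambda>_::nat. lborel :: real measure"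
    by standard
  let ?L = "\<Pi>\<^sub>M i\<in>{..<m}. lborel :: real measure"
  define r :: real where "r = 1 / (real m + 1)"
  have r: "0 < r" "real m * r \<le> 1"
    by (auto simp: r_def field_simps)
  have "(\<Pi>\<^sub>E i\<in>{..<m}. {0..r}) \<subseteq> unit_ball m"
  proof
    fix x assume x: "x \<in> (\<Pi>\<^sub>E i\<in>{..<m}. {0..r})"
    have "L2_set x {..<m} \<le> (\<Sum>i<m. \<bar>x i\<bar>)"
      by (rule L2_set_le_sum_abs)
    also have "\<dots> \<le> (\<Sum>i<m. r)"
      using x by (intro sum_mono) (auto simp: PiE_iff)
    also have "\<dots> \<le> 1"
      using r by simp
    finally show "x \<in> unit_ball m"
      using x by (auto simp: unit_ball_def real_vec_def space_PiM PiE_iff)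
  qed
  then have "emeasure ?L (\<Pi>\<^sub>E i\<in>{..<m}. {0..r}) \<le> emeasure ?L (unit_ball m)"
    by (intro emeasure_mono) auto
  moreover have "emeasure ?L (\<Pi>\<^sub>E i\<in>{..<m}. {0..r}) = ennreal r ^ m"
    using r by (subst emeasure_PiM) auto
  ultimately have pos: "emeasure ?L (unit_ball m) \<noteq> 0"
    using r by auto
  have "unit_ball m \<subseteq> (\<Pi>\<^sub>E i\<in>{..<m}. {-1..1})"
  proof
    fix x assume x: "x \<in> unit_ball m"
    have "\<bar>x i\<bar> \<le> 1" if "i < m" for i
    proof -
      have "\<bar>x i\<bar> \<le> L2_set (\<lambda>i. \<bar>x i\<bar>) {..<m}"
        using that by (intro member_le_L2_set) auto
      also have "\<dots> \<le> 1"
        using x by (simp add: unit_ball_def L2_set_def)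
      finally show ?thesis .
    qed
    then show "x \<in> (\<Pi>\<^sub>E i\<in>{..<m}. {-1..1})"
      using x by (auto simp: unit_ball_def real_vec_def space_PiM PiE_iff abs_le_iff)
  qed
  then have "emeasure ?L (unit_ball m) \<le> emeasure ?L (\<Pi>\<^sub>E i\<in>{..<m}. {-1..1})"
    by (intro emeasure_mono) auto
  moreover have "emeasure ?L (\<Pi>\<^sub>E i\<in>{..<m}. {-1..1}) = ennreal (2 ^ m)"
    by (subst emeasure_PiM) (auto simp flip: ennreal_power)
  ultimately have fin: "emeasure ?L (unit_ball m) \<noteq> \<infinity>"
    by (auto simp: top_unique)
  show ?thesis
    unfolding uniform_sphere_def
  proof (rule prob_space.prob_space_distr)
    show "prob_space (uniform_measure ?L (unit_ball m))"
      using pos fin by (rule prob_space_uniform_measure)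
    show "(\<lambda>x. \<lambda>i\<in>{..<m}. x i / L2_set x {..<m})
        \<in> uniform_measure ?L (unit_ball m) \<rightarrow>\<^sub>M real_vec m"
      unfolding real_vec_def L2_set_def by measurable
  qed
qed

lemma AE_uniform_sphere:
  assumes "m > 0"
  shows "AE x in uniform_sphere m. L2_set x {..<m} = 1"
proof -
  interpret product_sigma_finite "\<lambda>_::nat. lborel :: real measure"
    by standard
  let ?L = "\<Pi>\<^sub>M i\<in>{..<m}. lborel :: real measure"
  have "emeasure ?L (\<Pi>\<^sub>E i\<in>{..<m}. {0}) = 0"
    using assms by (subst emeasure_PiM) auto
  then have "AE x in ?L. x \<notin> (\<Pi>\<^sub>E i\<in>{..<m}. {0})"
    by (intro AE_not_in null_setsI sets_PiM_I_finite) auto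
  then have "AE x in ?L. x \<in> unit_ball m \<longrightarrow>
      L2_set (\<lambda>i\<in>{..<m}. x i / L2_set x {..<m}) {..<m} = 1"
  proof (rule AE_mp, intro AE_I2 impI)
    fix x assume x: "x \<in> space ?L" "x \<notin> (\<Pi>\<^sub>E i\<in>{..<m}. {0})"
    then have "\<exists>i\<in>{..<m}. x i \<noteq> 0"
      unfolding space_PiM PiE_iff by blast
    then have "L2_set x {..<m} \<noteq> 0"
      by (auto simp: L2_set_eq_0_iff)
    moreover have "L2_set (\<lambda>i\<in>{..<m}. x i / L2_set x {..<m}) {..<m}
        = L2_set (\<lambda>i. x i * inverse (L2_set x {..<m})) {..<m}"
      by (intro L2_set_cong) (auto simp: divide_inverse)
    ultimately show "L2_set (\<lambda>i\<in>{..<m}. x i / L2_set x {..<m}) {..<m} = 1"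
      by (simp add: L2_set_left_distrib [symmetric])
  qed
  then have *: "AE x in uniform_measure ?L (unit_ball m).
      L2_set (\<lambda>i\<in>{..<m}. x i / L2_set x {..<m}) {..<m} = 1"
    by (intro AE_uniform_measureI) auto
  have "(\<lambda>x. \<lambda>i\<in>{..<m}. x i / L2_set x {..<m}) \<in> uniform_measure ?L (unit_ball m) \<rightarrow>\<^sub>M real_vec m"
    "{x \<in> space (real_vec m). L2_set x {..<m} = 1} \<in> sets (real_vec m)"
    unfolding real_vec_def L2_set_def by measurable
  then show ?thesis
    using * unfolding uniform_sphere_def by (subst AE_distr_iff) auto
qed

definition uniform_on_cq_sphere :: "'w measure \<Rightarrow> nat \<Rightarrow> ('w \<Rightarrow> nat \<Rightarrow> cquat) \<Rightarrow> bool" where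
  "uniform_on_cq_sphere M n \<xi> \<longleftrightarrow>
    \<xi> \<in> M \<rightarrow>\<^sub>M cquat_vec n \<and>
    distr M (real_vec (4 * n)) (\<lambda>\<omega>. cq_stack n (\<xi> \<omega>)) = uniform_sphere (4 * n)"

lemma AE_in_cq_sphere:
  assumes "n > 0" and unif: "uniform_on_cq_sphere M n \<xi>"
  shows "AE \<omega> in M. \<xi> \<omega> \<in> cq_sphere n"
proof -
  have \<xi> [measurable]: "\<xi> \<in> M \<rightarrow>\<^sub>M cquat_vec n"
    using unif by (simp add: uniform_on_cq_sphere_def)
  have "AE x in distr M (real_vec (4 * n)) (\<lambda>\<omega>. cq_stack n (\<xi> \<omega>)). L2_set x {..<4 * n} = 1"
    using unif AE_uniform_sphere [of "4 * n"] \<open>n > 0\<close>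
    unfolding uniform_on_cq_sphere_def by (metis mult_pos_pos zero_less_numeral)
  then have "AE \<omega> in M. L2_set (cq_stack n (\<xi> \<omega>)) {..<4 * n} = 1"
    by (rule AE_distrD [rotated]) measurable
  then show ?thesis
    using measurable_space [OF \<xi>] by (auto simp: cq_sphere_def L2_set_cq_stack elim!: AE_mp)
qed

end

theory Submission
  imports Defs
begin

text \<open>
  The real part of \<open>a\<^sup>\<top> \<xi>\<close> is, up to the signs of two of the four blocks, the Euclidean inner product
  of two independent uniform points of the unit sphere of \<open>\<real>\<^sup>4\<^sup>n\<close>.  Conditioning on \<open>a\<close> reduces the
  claim to a lower bound for the measure of a spherical cap of height \<open>t = sqrt (\<gamma> * ln n / n)\<close> that is
  uniform in the centre of the cap (\<open>prob_Re_dot_ge\<close>).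

  The uniform distribution is the radial projection of Lebesgue measure on the ball, and the solid cap
  of the ball is projected into the spherical cap, so its proportion of the ball is a lower bound
  (\<open>uniform_sphere_halfspace_ge\<close>).  Lebesgue measure is
  invariant under rotations, which are products of shears, so the solid cap may be taken around a
  coordinate axis (\<open>nn_integral_norm_inner_rotate_to_axis\<close>), where it contains a cylinder between the
  heights \<open>t\<close> and \<open>t + d\<close> (\<open>emeasure_ball_cap_ge\<close>).  The ratio of the ball volumes in dimensions \<open>4 * n - 1\<close>
  and \<open>4 * n\<close> is of order \<open>sqrt n\<close>, by log-convexity of the Gamma function (\<open>unit_ball_vol_ratio_ge\<close>).
  Hence the cap has probability at least a constant times \<open>d * sqrt n * (1 - (t + d)\<^sup>2) ^ (2 * n)\<close>.

  For \<open>d = \<epsilon> * t\<close> the last factor is about \<open>n powr (- 2 * (1 + \<epsilon>)\<^sup>2 * \<gamma>)\<close>.  The exponent \<open>4.5 * \<gamma>\<close>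
  leaves enough room for the crude estimate \<open>1 - x \<ge> exp (- 2 * x)\<close>, which costs a factor \<open>2\<close> in the
  exponent.  The estimate holds for all large \<open>n\<close>; the finitely many remaining ones contribute a positive
  minimum (\<open>cap_bound_ge\<close>).
\<close>

section \<open>Rotation invariance of Lebesgue measure\<close>

text \<open>
  By Fubini the \<open>i\<close>-th coordinate can be integrated first, and with the others fixed the shear only
  translates it.
\<close>
lemma nn_integral_PiM_lborel_shear:
  fixes f :: "('i \<Rightarrow> real) \<Rightarrow> ennreal"
  assumes "finite I" "i \<in> I" "j \<in> I" "i \<noteq> j"
    and [measurable]: "f \<in> borel_measurable (\<Pi>\<^sub>M k\<in>I. lborel)"
  shows "(\<integral>\<^sup>+x. f (x(i := x i + c * x j)) \<partial>(\<Pi>\<^sub>M k\<in>I. lborel)) = (\<integral>\<^sup>+x. f x \<partial>(\<Pi>\<^sub>M k\<in>I. lborel))"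
proof -
  interpret product_sigma_finite "\<lambda>_::'i. lborel :: real measure"
    by standard
  define J where "J = I - {i}"
  have J: "finite J" "i \<notin> J" "j \<in> J" "I = insert i J"
    using assms by (auto simp: J_def)
  have "(\<lambda>x. x(i := x i + c * x j)) \<in> (\<Pi>\<^sub>M k\<in>I. lborel) \<rightarrow>\<^sub>M (\<Pi>\<^sub>M k\<in>insert i I. lborel)"
    using assms(2,3) by measurable
  then have upd: "(\<lambda>x. x(i := x i + c * x j)) \<in> (\<Pi>\<^sub>M k\<in>I. lborel) \<rightarrow>\<^sub>M (\<Pi>\<^sub>M k\<in>I. lborel)"
    using assms(2) by (simp add: insert_absorb)
  have f [measurable]: "f \<in> borel_measurable (\<Pi>\<^sub>M k\<in>insert i J. lborel)"
    using assms(5) J(4) by simp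
  have "(\<integral>\<^sup>+x. f (x(i := x i + c * x j)) \<partial>(\<Pi>\<^sub>M k\<in>I. lborel))
      = (\<integral>\<^sup>+x. \<integral>\<^sup>+y. f (x(i := c * x j + 1 * y)) \<partial>lborel \<partial>(\<Pi>\<^sub>M k\<in>J. lborel))"
    using measurable_compose [OF upd assms(5)] J
    by (simp add: product_nn_integral_insert add.commute assms(4) [symmetric])
  also have "\<dots> = (\<integral>\<^sup>+x. \<integral>\<^sup>+y. f (x(i := y)) \<partial>lborel \<partial>(\<Pi>\<^sub>M k\<in>J. lborel))"
  proof (rule nn_integral_cong)
    fix x :: "'i \<Rightarrow> real" assume [measurable]: "x \<in> space (\<Pi>\<^sub>M k\<in>J. lborel)"
    have "(\<lambda>y. f (x(i := y))) \<in> borel_measurable borel"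
      by measurable
    from nn_integral_real_affine [OF this, of 1 "c * x j"]
    show "(\<integral>\<^sup>+y. f (x(i := c * x j + 1 * y)) \<partial>lborel) = (\<integral>\<^sup>+y. f (x(i := y)) \<partial>lborel)"
      by simp
  qed
  also have "\<dots> = (\<integral>\<^sup>+x. f x \<partial>(\<Pi>\<^sub>M k\<in>I. lborel))"
    unfolding J(4) using J by (simp add: product_nn_integral_insert)
  finally show ?thesis .
qed

text \<open>
  A rotation of a coordinate plane with \<open>s \<noteq> 0\<close> is a product of three shears: add \<open>b\<close> times the \<open>j\<close>-th
  coordinate to the \<open>i\<close>-th, then \<open>s\<close> times the \<open>i\<close>-th to the \<open>j\<close>-th, then repeat the first shear,
  where \<open>b = (c - 1) / s\<close>.  For the angle \<open>\<theta>\<close> this \<open>b\<close> is \<open>- tan (\<theta> / 2)\<close>, so of all rotations only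
  the identity and the half turn are excluded.
\<close>
lemma nn_integral_PiM_lborel_plane_rotation:
  fixes f :: "('i \<Rightarrow> real) \<Rightarrow> ennreal"
  assumes I: "finite I" "i \<in> I" "j \<in> I" "i \<noteq> j"
    and f [measurable]: "f \<in> borel_measurable (\<Pi>\<^sub>M k\<in>I. lborel)"
    and cs: "c\<^sup>2 + s\<^sup>2 = 1" "s \<noteq> 0"
  shows "(\<integral>\<^sup>+x. f (x(i := c * x i - s * x j, j := s * x i + c * x j)) \<partial>(\<Pi>\<^sub>M k\<in>I. lborel))
    = (\<integral>\<^sup>+x. f x \<partial>(\<Pi>\<^sub>M k\<in>I. lborel))"
proof -
  define b where "b = (c - 1) / s"
  define E where "E p q d = (\<lambda>x::'i \<Rightarrow> real. x(p := x p + d * x q))" for p q d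
  have insI: "insert p I = I" if "p \<in> I" for p
    using that by auto
  have E_meas: "E p q d \<in> (\<Pi>\<^sub>M k\<in>I. lborel) \<rightarrow>\<^sub>M (\<Pi>\<^sub>M k\<in>I. lborel)" if "p \<in> I" "q \<in> I" for p q d
  proof -
    have "E p q d \<in> (\<Pi>\<^sub>M k\<in>I. lborel) \<rightarrow>\<^sub>M (\<Pi>\<^sub>M k\<in>insert p I. lborel)"
      unfolding E_def using that by measurable
    then show ?thesis
      using insI that by simp
  qed
  note comp = measurable_compose [OF E_meas]
  have c: "1 + b * s = c" and bc: "b * (1 + c) = - s"
    using cs by (auto simp: b_def field_simps power2_eq_square)
  have "x j + s * (x i + b * x j) = s * x i + (1 + b * s) * x j" for x
    by (simp add: algebra_simps)
  then have rot_j: "x j + s * (x i + b * x j) = s * x i + c * x j" for x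
    unfolding c .
  have "x i + b * x j + b * (s * x i + c * x j) = (1 + b * s) * x i + (b * (1 + c)) * x j" for x
    by (simp add: algebra_simps)
  then have rot_i: "x i + b * x j + b * (s * x i + c * x j) = c * x i - s * x j" for x
    unfolding c bc by simp
  have rot: "x(i := c * x i - s * x j, j := s * x i + c * x j) = E i j b (E j i s (E i j b x))" for x
    using I(4) by (auto simp: E_def fun_eq_iff rot_i rot_j)
  have f1: "(\<lambda>x. f (E i j b x)) \<in> borel_measurable (\<Pi>\<^sub>M k\<in>I. lborel)"
    using I by (intro comp f)
  have f2: "(\<lambda>x. f (E i j b (E j i s x))) \<in> borel_measurable (\<Pi>\<^sub>M k\<in>I. lborel)"
    using I by (intro comp f1)
  have shear: "(\<integral>\<^sup>+x. g (E p q d x) \<partial>(\<Pi>\<^sub>M k\<in>I. lborel)) = (\<integral>\<^sup>+x. g x \<partial>(\<Pi>\<^sub>M k\<in>I. lborel))"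
    if "p \<in> I" "q \<in> I" "p \<noteq> q" "g \<in> borel_measurable (\<Pi>\<^sub>M k\<in>I. lborel)" for p q d g
    unfolding E_def using I(1) that by (rule nn_integral_PiM_lborel_shear)
  show ?thesis
    unfolding rot shear [OF I(2,3,4) f2] shear [OF I(3,2) I(4) [symmetric] f1] shear [OF I(2,3,4) f] ..
qed

lemma sum_eq_two_plus_rest:
  fixes h :: "'i \<Rightarrow> 'b::comm_monoid_add"
  assumes "finite I" "i \<in> I" "j \<in> I" "i \<noteq> j"
  shows "(\<Sum>k\<in>I. h k) = h i + h j + (\<Sum>k\<in>I - {i, j}. h k)"
proof -
  have "(\<Sum>k\<in>I. h k) = h i + (\<Sum>k\<in>I - {i}. h k)"
    using assms by (intro sum.remove)
  also have "(\<Sum>k\<in>I - {i}. h k) = h j + (\<Sum>k\<in>I - {i} - {j}. h k)"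
    using assms by (intro sum.remove) auto
  finally show ?thesis
    by (simp add: add.assoc Diff_insert [symmetric] insert_commute)
qed

text \<open>
  The rotation of the \<open>(i, j)\<close>-plane that takes the \<open>i\<close>-th axis to the direction of \<open>(v i, v j)\<close> keeps
  \<open>\<Sum>k\<in>I. (x k)\<^sup>2\<close> and turns the functional \<open>v\<close> into one that ignores the \<open>j\<close>-th coordinate.
\<close>
lemma nn_integral_norm_inner_eliminate_coordinate:
  fixes f :: "real \<Rightarrow> real \<Rightarrow> ennreal" and v :: "'i \<Rightarrow> real"
  assumes I: "finite I" "i \<in> I" "j \<in> I" "i \<noteq> j" and "v j \<noteq> 0"
    and [measurable]: "case_prod f \<in> borel_measurable (borel \<Otimes>\<^sub>M borel)"
  defines "r \<equiv> sqrt ((v i)\<^sup>2 + (v j)\<^sup>2)"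
  shows "(\<integral>\<^sup>+x. f (\<Sum>k\<in>I. (x k)\<^sup>2) (\<Sum>k\<in>I. v k * x k) \<partial>(\<Pi>\<^sub>M k\<in>I. lborel))
    = (\<integral>\<^sup>+x. f (\<Sum>k\<in>I. (x k)\<^sup>2) (\<Sum>k\<in>I. (v(i := r, j := 0)) k * x k) \<partial>(\<Pi>\<^sub>M k\<in>I. lborel))"
proof -
  have r: "r > 0" "r\<^sup>2 = (v i)\<^sup>2 + (v j)\<^sup>2"
    using \<open>v j \<noteq> 0\<close> by (auto simp: r_def add_nonneg_pos)
  define c s where "c = v i / r" and "s = v j / r"
  have cs: "c\<^sup>2 + s\<^sup>2 = 1" "s \<noteq> 0"
    using r \<open>v j \<noteq> 0\<close> by (auto simp: c_def s_def power_divide add_divide_distrib [symmetric])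
  have vcs: "v i = r * c" "v j = r * s"
    using r by (auto simp: c_def s_def)
  define T where "T = (\<lambda>x::'i \<Rightarrow> real. x(i := c * x i - s * x j, j := s * x i + c * x j))"
  have T: "T x i = c * x i - s * x j" "T x j = s * x i + c * x j" "k \<notin> {i, j} \<Longrightarrow> T x k = x k" for x k
    using I(4) by (auto simp: T_def)
  have "(\<integral>\<^sup>+x. f (\<Sum>k\<in>I. (x k)\<^sup>2) (\<Sum>k\<in>I. v k * x k) \<partial>(\<Pi>\<^sub>M k\<in>I. lborel))
    = (\<integral>\<^sup>+x. f (\<Sum>k\<in>I. (T x k)\<^sup>2) (\<Sum>k\<in>I. v k * T x k) \<partial>(\<Pi>\<^sub>M k\<in>I. lborel))"
    unfolding T_def by (rule nn_integral_PiM_lborel_plane_rotation [OF I _ cs, symmetric]) measurable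
  also have "\<dots> = (\<integral>\<^sup>+x. f (\<Sum>k\<in>I. (x k)\<^sup>2) (\<Sum>k\<in>I. (v(i := r, j := 0)) k * x k) \<partial>(\<Pi>\<^sub>M k\<in>I. lborel))"
  proof (rule nn_integral_cong)
    fix x :: "'i \<Rightarrow> real"
    have "(c * x i - s * x j)\<^sup>2 + (s * x i + c * x j)\<^sup>2 = (c\<^sup>2 + s\<^sup>2) * ((x i)\<^sup>2 + (x j)\<^sup>2)"
      by (simp add: power2_eq_square algebra_simps)
    then have "(\<Sum>k\<in>I. (T x k)\<^sup>2) = (\<Sum>k\<in>I. (x k)\<^sup>2)"
      using cs by (simp add: sum_eq_two_plus_rest [OF I] T)
    moreover have "v i * (c * x i - s * x j) + v j * (s * x i + c * x j) = r * (c\<^sup>2 + s\<^sup>2) * x i"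
      by (simp add: vcs power2_eq_square algebra_simps)
    then have "(\<Sum>k\<in>I. v k * T x k) = (\<Sum>k\<in>I. (v(i := r, j := 0)) k * x k)"
      using cs I(4) by (simp add: sum_eq_two_plus_rest [OF I] T)
    ultimately show "f (\<Sum>k\<in>I. (T x k)\<^sup>2) (\<Sum>k\<in>I. v k * T x k)
        = f (\<Sum>k\<in>I. (x k)\<^sup>2) (\<Sum>k\<in>I. (v(i := r, j := 0)) k * x k)"
      by simp
  qed
  finally show ?thesis .
qed

text \<open>
  Rotation invariance in the form needed here: under Lebesgue measure the joint law of the norm and of
  a linear functional depends on the functional only through its length.  One plane rotation for each
  further non-zero coordinate of \<open>v\<close> moves \<open>v\<close> to the \<open>i\<close>-th axis.  The sign of the result \<open>e\<close> is left
  open: it is negative when \<open>v\<close> already lies on the negative half of the axis, where nothing is rotated.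
\<close>
lemma nn_integral_norm_inner_rotate_to_axis:
  fixes f :: "real \<Rightarrow> real \<Rightarrow> ennreal" and v :: "'i \<Rightarrow> real"
  assumes I: "finite I" "i \<in> I"
    and f [measurable]: "case_prod f \<in> borel_measurable (borel \<Otimes>\<^sub>M borel)"
  obtains e where "e\<^sup>2 = (\<Sum>k\<in>I. (v k)\<^sup>2)"
    and "(\<integral>\<^sup>+x. f (\<Sum>k\<in>I. (x k)\<^sup>2) (\<Sum>k\<in>I. v k * x k) \<partial>(\<Pi>\<^sub>M k\<in>I. lborel))
      = (\<integral>\<^sup>+x. f (\<Sum>k\<in>I. (x k)\<^sup>2) (e * x i) \<partial>(\<Pi>\<^sub>M k\<in>I. lborel))"
proof -
  define F where "F v = (\<integral>\<^sup>+x. f (\<Sum>k\<in>I. (x k)\<^sup>2) (\<Sum>k\<in>I. v k * x k) \<partial>(\<Pi>\<^sub>M k\<in>I. lborel))" for v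
  have "\<exists>w. (\<forall>k\<in>I - {i}. w k = 0) \<and> (\<Sum>k\<in>I. (w k)\<^sup>2) = (\<Sum>k\<in>I. (v k)\<^sup>2) \<and> F w = F v"
    if "finite J" "J \<subseteq> I - {i}" "\<forall>k\<in>I - {i} - J. v k = 0" for J v
    using that
  proof (induction J arbitrary: v)
    case empty
    then show ?case by auto
  next
    case (insert j J)
    show ?case
    proof (cases "v j = 0")
      case True
      then show ?thesis
        using insert.prems by (intro insert.IH) auto
    next
      case False
      define v' where "v' = v(i := sqrt ((v i)\<^sup>2 + (v j)\<^sup>2), j := 0)"
      have ij: "j \<in> I" "i \<noteq> j"
        using insert.prems by auto
      have "F v' = F v"
        unfolding F_def v'_def using I ij False
        by (intro nn_integral_norm_inner_eliminate_coordinate [symmetric] f) auto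
      moreover have "(\<Sum>k\<in>I. (v' k)\<^sup>2) = (\<Sum>k\<in>I. (v k)\<^sup>2)"
        using ij by (simp add: sum_eq_two_plus_rest [OF I ij] v'_def)
      moreover have "\<exists>w. (\<forall>k\<in>I - {i}. w k = 0) \<and> (\<Sum>k\<in>I. (w k)\<^sup>2) = (\<Sum>k\<in>I. (v' k)\<^sup>2) \<and> F w = F v'"
        using insert.prems ij by (intro insert.IH) (auto simp: v'_def)
      ultimately show ?thesis
        by simp
    qed
  qed
  from this [of "I - {i}" v] obtain w
    where w: "\<forall>k\<in>I - {i}. w k = 0" "(\<Sum>k\<in>I. (w k)\<^sup>2) = (\<Sum>k\<in>I. (v k)\<^sup>2)" "F w = F v"
    using I by auto
  have "(\<Sum>k\<in>I. (w k)\<^sup>2) = (w i)\<^sup>2" "\<And>x. (\<Sum>k\<in>I. w k * x k) = w i * x i"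
    using w(1) I by (simp_all add: sum.remove [of I i])
  then show thesis
    using w that [of "w i"] by (simp add: F_def)
qed

section \<open>Caps of the ball\<close>

text \<open>
  Fubini along the axis of the cylinder, the cross section being a ball in one dimension less.
\<close>
lemma emeasure_PiM_lborel_cylinder:
  fixes a b r :: real
  assumes I: "finite I" "i \<in> I" and "a \<le> b" "r > 0"
  shows "emeasure (\<Pi>\<^sub>M k\<in>I. lborel)
      {x \<in> space (\<Pi>\<^sub>M k\<in>I. lborel). x i \<in> {a..b} \<and> (\<Sum>k\<in>I - {i}. (x k)\<^sup>2) \<le> r\<^sup>2}
    = ennreal ((b - a) * unit_ball_vol (card I - 1) * r ^ (card I - 1))"
proof -
  interpret product_sigma_finite "\<lambda>_. lborel :: real measure"
    by standard
  define J where "J = I - {i}"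
  have J: "finite J" "i \<notin> J" "I = insert i J"
    using I by (auto simp: J_def)
  have card: "card I = Suc (card J)"
    using J by simp
  let ?L = "\<lambda>I. \<Pi>\<^sub>M k\<in>I. lborel :: real measure"
  define C where "C = {x \<in> space (?L I). x i \<in> {a..b} \<and> (\<Sum>k\<in>J. (x k)\<^sup>2) \<le> r\<^sup>2}"
  define D where "D = {x. sqrt (\<Sum>k\<in>J. (x k)\<^sup>2) \<le> r} \<inter> space (?L J)"
  have [measurable]: "C \<in> sets (?L (insert i J))"
    unfolding C_def J(3) by measurable
  have [measurable]: "D \<in> sets (?L J)"
    unfolding D_def by measurable
  have "emeasure (?L I) C = (\<integral>\<^sup>+x. indicator C x \<partial>?L (insert i J))"
    using J(3) by simp
  also have "\<dots> = (\<integral>\<^sup>+x. \<integral>\<^sup>+y. indicator C (x(i := y)) \<partial>lborel \<partial>?L J)"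
    using J by (intro product_nn_integral_insert) auto
  also have "\<dots> = (\<integral>\<^sup>+x. \<integral>\<^sup>+y. indicator D x * indicator {a..b} y \<partial>lborel \<partial>?L J)"
  proof (intro nn_integral_cong)
    fix x :: "'a \<Rightarrow> real" and y assume x: "x \<in> space (?L J)"
    have "(\<Sum>k\<in>J. ((x(i := y)) k)\<^sup>2) = (\<Sum>k\<in>J. (x k)\<^sup>2)"
      using J by (intro sum.cong) auto
    moreover have "sqrt (\<Sum>k\<in>J. (x k)\<^sup>2) \<le> r \<longleftrightarrow> (\<Sum>k\<in>J. (x k)\<^sup>2) \<le> r\<^sup>2"
      using \<open>r > 0\<close> by (intro real_sqrt_le_iff') (auto simp: sum_nonneg)
    ultimately have "x(i := y) \<in> C \<longleftrightarrow> x \<in> D \<and> y \<in> {a..b}"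
      using x J unfolding C_def D_def by (auto simp: space_PiM PiE_def extensional_def)
    then show "indicator C (x(i := y)) = (indicator D x * indicator {a..b} y :: ennreal)"
      by (auto simp: indicator_def)
  qed
  also have "\<dots> = emeasure (?L J) D * ennreal (b - a)"
    using \<open>a \<le> b\<close> by (simp add: nn_integral_cmult nn_integral_multc)
  also have "emeasure (?L J) D = ennreal (unit_ball_vol (real (card J)) * r ^ card J)"
    unfolding D_def using J \<open>r > 0\<close> by (intro emeasure_cball_aux)
  finally show ?thesis
    using \<open>a \<le> b\<close> \<open>r > 0\<close>
    by (simp add: C_def J_def [symmetric] card ennreal_mult [symmetric] mult_ac)
qed

text \<open>
  After a rotation the cap is cut off at height \<open>t\<close> on a coordinate axis.  There it contains the
  cylinder of height \<open>d\<close> whose base is the section of the ball at height \<open>t + d\<close>, since the sections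
  shrink with the height.
\<close>
lemma emeasure_ball_cap_ge:
  fixes t d :: real and v :: "'i \<Rightarrow> real"
  assumes I: "finite I" "I \<noteq> {}" and v: "(\<Sum>k\<in>I. (v k)\<^sup>2) = 1"
    and td: "t \<ge> 0" "d \<ge> 0" "t + d < 1"
  shows "ennreal (d * unit_ball_vol (card I - 1) * sqrt (1 - (t + d)\<^sup>2) ^ (card I - 1))
    \<le> emeasure (\<Pi>\<^sub>M k\<in>I. lborel)
        {x \<in> space (\<Pi>\<^sub>M k\<in>I. lborel). (\<Sum>k\<in>I. (x k)\<^sup>2) \<le> 1 \<and> t \<le> (\<Sum>k\<in>I. v k * x k)}"
proof -
  let ?L = "\<Pi>\<^sub>M k\<in>I. lborel :: real measure"
  obtain i where i: "i \<in> I"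
    using I by auto
  define f :: "real \<Rightarrow> real \<Rightarrow> ennreal" where "f q u = indicator ({..1} \<times> {t..}) (q, u)" for q u
  have f [measurable]: "case_prod f \<in> borel_measurable (borel \<Otimes>\<^sub>M borel)"
    unfolding f_def by simp
  obtain e where e: "e\<^sup>2 = (\<Sum>k\<in>I. (v k)\<^sup>2)"
    and rot: "(\<integral>\<^sup>+x. f (\<Sum>k\<in>I. (x k)\<^sup>2) (\<Sum>k\<in>I. v k * x k) \<partial>?L)
      = (\<integral>\<^sup>+x. f (\<Sum>k\<in>I. (x k)\<^sup>2) (e * x i) \<partial>?L)"
    using nn_integral_norm_inner_rotate_to_axis [OF I(1) i f, of v] by blast
  define W where "W g = {x \<in> space ?L. (\<Sum>k\<in>I. (x k)\<^sup>2) \<le> 1 \<and> t \<le> g x}" for g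
  have W: "emeasure ?L (W g) = (\<integral>\<^sup>+x. f (\<Sum>k\<in>I. (x k)\<^sup>2) (g x) \<partial>?L)"
    if [measurable]: "g \<in> borel_measurable ?L" for g
  proof -
    have "W g \<in> sets ?L"
      unfolding W_def by measurable
    then have "emeasure ?L (W g) = (\<integral>\<^sup>+x. indicator (W g) x \<partial>?L)"
      by simp
    also have "\<dots> = (\<integral>\<^sup>+x. f (\<Sum>k\<in>I. (x k)\<^sup>2) (g x) \<partial>?L)"
      by (intro nn_integral_cong) (auto simp: W_def f_def indicator_def)
    finally show ?thesis .
  qed
  define r where "r = sqrt (1 - (t + d)\<^sup>2)"
  have "(t + d)\<^sup>2 < 1"
    using td by (simp add: abs_square_less_1)
  then have r: "r > 0" "r\<^sup>2 = 1 - (t + d)\<^sup>2"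
    by (auto simp: r_def)
  \<comment> \<open>For \<open>e = -1\<close> the cap lies on the negative half of the axis, and so does the cylinder.\<close>
  define a where "a = (if e = 1 then t else - (t + d))"
  let ?C = "{x \<in> space ?L. x i \<in> {a..a + d} \<and> (\<Sum>k\<in>I - {i}. (x k)\<^sup>2) \<le> r\<^sup>2}"
  have "e = 1 \<or> e = -1"
    using e v by (simp add: power2_eq_1_iff)
  then have slab: "t \<le> e * y \<and> y\<^sup>2 \<le> (t + d)\<^sup>2" if "y \<in> {a..a + d}" for y
    using that td by (auto simp: a_def abs_le_square_iff [symmetric] split: if_splits)
  have "?C \<subseteq> W (\<lambda>x. e * x i)"
  proof
    fix x assume x: "x \<in> ?C"
    have "(\<Sum>k\<in>I. (x k)\<^sup>2) = (x i)\<^sup>2 + (\<Sum>k\<in>I - {i}. (x k)\<^sup>2)"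
      by (rule sum.remove [OF I(1) i])
    then show "x \<in> W (\<lambda>x. e * x i)"
      using x slab [of "x i"] r(2) by (simp add: W_def)
  qed
  then have "emeasure ?L ?C \<le> emeasure ?L (W (\<lambda>x. e * x i))"
    using i by (intro emeasure_mono) (auto simp: W_def)
  also have "\<dots> = emeasure ?L (W (\<lambda>x. \<Sum>k\<in>I. v k * x k))"
    using i rot by (simp add: W)
  finally show ?thesis
    using emeasure_PiM_lborel_cylinder [OF I(1) i _ r(1), of a "a + d"] td
    by (simp add: W_def r_def)
qed

text \<open>
  Log-convexity at the midpoint of \<open>z\<close> and \<open>z + 1\<close> bounds \<open>(Gamma (z + 1 / 2))\<^sup>2\<close> by
  \<open>Gamma z * Gamma (z + 1)\<close>, which is \<open>(Gamma (z + 1))\<^sup>2 / z\<close>.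
\<close>
lemma Gamma_add_half_ge:
  fixes z :: real
  assumes "z > 0"
  shows "sqrt z * Gamma (z + 1 / 2) \<le> Gamma (z + 1)"
proof -
  have pos: "Gamma z > 0" "Gamma (z + 1 / 2) > 0" "Gamma (z + 1) > 0"
    using assms by (auto intro!: Gamma_real_pos)
  have "(ln \<circ> Gamma) ((1 - 1/2) *\<^sub>R z + (1/2) *\<^sub>R (z + 1))
      \<le> (1 - 1/2) * (ln \<circ> Gamma) z + (1/2) * (ln \<circ> Gamma) (z + 1)"
    using assms by (intro convex_onD [OF log_convex_Gamma_real]) auto
  moreover have "(1 - 1/2) *\<^sub>R z + (1/2) *\<^sub>R (z + 1) = z + 1 / 2"
    by (simp add: field_simps)
  ultimately have "2 * ln (Gamma (z + 1 / 2)) \<le> ln (Gamma z) + ln (Gamma (z + 1))"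
    by simp
  then have "ln ((Gamma (z + 1 / 2))\<^sup>2) \<le> ln (Gamma z * Gamma (z + 1))"
    using pos by (simp add: ln_mult ln_realpow)
  then have "(Gamma (z + 1 / 2))\<^sup>2 \<le> Gamma z * Gamma (z + 1)"
    using pos by (subst (asm) ln_le_cancel_iff) auto
  then have "z * (Gamma (z + 1 / 2))\<^sup>2 \<le> (z * Gamma z) * Gamma (z + 1)"
    using assms by simp
  also have "z * Gamma z = Gamma (z + 1)"
    using assms by (intro Gamma_plus1 [symmetric]) (auto elim: nonpos_Ints_cases)
  finally have "(sqrt z * Gamma (z + 1 / 2))\<^sup>2 \<le> (Gamma (z + 1))\<^sup>2"
    using assms by (simp add: power_mult_distrib power2_eq_square [of "Gamma (z + 1)"])
  then show ?thesis
    by (rule power2_le_imp_le) (use assms in auto)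
qed

text \<open>
  This ratio of volumes makes the constant independent of the dimension: it supplies the factor of
  order \<open>sqrt n\<close> that compensates for the height of the cylinder, which is of order \<open>sqrt (ln n / n)\<close>.
\<close>
lemma unit_ball_vol_ratio_ge:
  fixes x :: real
  assumes "x > 0"
  shows "sqrt (x / (2 * pi)) * unit_ball_vol x \<le> unit_ball_vol (x - 1)"
proof -
  have "pi powr (x / 2) = pi powr ((x - 1) / 2) * sqrt pi"
    by (simp add: powr_half_sqrt [symmetric] powr_add [symmetric] diff_divide_distrib)
  moreover have "sqrt (x / (2 * pi)) * sqrt pi = sqrt (x / 2)"
    by (simp add: real_sqrt_mult [symmetric])
  ultimately have "sqrt (x / (2 * pi)) * unit_ball_vol x
      = pi powr ((x - 1) / 2) * (sqrt (x / 2) / Gamma (x / 2 + 1))"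
    by (simp add: unit_ball_vol_def mult_ac)
  also have "sqrt (x / 2) / Gamma (x / 2 + 1) \<le> 1 / Gamma (x / 2 + 1 / 2)"
    using Gamma_add_half_ge [of "x / 2"] assms by (simp add: field_simps)
  finally show ?thesis
    by (simp add: unit_ball_vol_def mult_left_mono field_simps)
qed

section \<open>Caps of the sphere\<close>

lemma emeasure_unit_ball: "emeasure (\<Pi>\<^sub>M k\<in>{..<m}. lborel) (unit_ball m) = ennreal (unit_ball_vol m)"
proof -
  have "unit_ball m = {x. sqrt (\<Sum>k<m. (x k)\<^sup>2) \<le> 1} \<inter> space (\<Pi>\<^sub>M k\<in>{..<m}. lborel)"
    by (auto simp: unit_ball_def L2_set_def real_vec_def space_PiM)
  then show ?thesis
    using emeasure_cball_aux [of "{..<m}" 1] by simp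
qed

text \<open>
  The uniform distribution is the radial projection of a uniform point \<open>x\<close> of the ball.  Projecting
  divides the non-negative inner product with \<open>v\<close> by a norm of at most \<open>1\<close>, so a point of the solid cap
  is projected into the spherical cap, and the solid cap may be measured instead.
\<close>
lemma uniform_sphere_halfspace_ge:
  fixes t d :: real and v :: "nat \<Rightarrow> real"
  assumes m: "m > 0" and v: "(\<Sum>k<m. (v k)\<^sup>2) = 1" and td: "t > 0" "d \<ge> 0" "t + d < 1"
  shows "ennreal (d * sqrt (m / (2 * pi)) * sqrt (1 - (t + d)\<^sup>2) ^ (m - 1))
    \<le> emeasure (uniform_sphere m) {x \<in> space (real_vec m). t \<le> (\<Sum>k<m. v k * x k)}"
proof -
  let ?L = "\<Pi>\<^sub>M k\<in>{..<m}. lborel :: real measure"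
  let ?H = "{x \<in> space (real_vec m). t \<le> (\<Sum>k<m. v k * x k)}"
  let ?W = "{x \<in> space ?L. (\<Sum>k<m. (x k)\<^sup>2) \<le> 1 \<and> t \<le> (\<Sum>k<m. v k * x k)}"
  define proj where "proj x = (\<lambda>k\<in>{..<m}. x k / L2_set x {..<m})" for x :: "nat \<Rightarrow> real"
  have proj [measurable]: "proj \<in> ?L \<rightarrow>\<^sub>M real_vec m"
    unfolding proj_def real_vec_def L2_set_def by measurable
  have H [measurable]: "?H \<in> sets (real_vec m)"
    unfolding real_vec_def by measurable
  have sub: "?W \<subseteq> unit_ball m \<inter> (proj -` ?H \<inter> space ?L)"
  proof
    fix x assume x: "x \<in> ?W"
    define q where "q = L2_set x {..<m}"
    have "q \<noteq> 0"
    proof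
      assume "q = 0"
      then have "\<forall>k\<in>{..<m}. x k = 0"
        by (simp add: q_def L2_set_eq_0_iff)
      then show False
        using x td by simp
    qed
    moreover have "q \<ge> 0" "q \<le> 1"
      using x by (simp_all add: q_def L2_set_def sum_nonneg)
    ultimately have "0 < q" "q \<le> 1"
      by simp_all
    moreover have "t \<le> (\<Sum>k<m. v k * x k)"
      using x by simp
    ultimately have "t * q \<le> (\<Sum>k<m. v k * x k)"
      using td mult_left_le [of q t] by linarith
    then have "t \<le> (\<Sum>k<m. v k * x k) / q"
      using \<open>0 < q\<close> by (simp add: field_simps)
    also have "\<dots> = (\<Sum>k<m. v k * proj x k)"
      by (simp add: proj_def q_def sum_divide_distrib)
    finally show "x \<in> unit_ball m \<inter> (proj -` ?H \<inter> space ?L)"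
      using x \<open>q \<le> 1\<close> measurable_space [OF proj, of x]
      by (simp add: unit_ball_def q_def real_vec_def space_PiM)
  qed
  have "d * sqrt (m / (2 * pi)) * sqrt (1 - (t + d)\<^sup>2) ^ (m - 1) * unit_ball_vol m
      = d * (sqrt (m / (2 * pi)) * unit_ball_vol m) * sqrt (1 - (t + d)\<^sup>2) ^ (m - 1)"
    by simp
  also have "\<dots> \<le> d * unit_ball_vol (m - 1) * sqrt (1 - (t + d)\<^sup>2) ^ (m - 1)"
  proof -
    have "(t + d)\<^sup>2 \<le> 1"
      using td by (simp add: abs_square_le_1)
    then show ?thesis
      using unit_ball_vol_ratio_ge [of m] m td
      by (intro mult_right_mono mult_left_mono) (auto simp: of_nat_diff)
  qed
  finally have "d * sqrt (m / (2 * pi)) * sqrt (1 - (t + d)\<^sup>2) ^ (m - 1)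
      \<le> d * unit_ball_vol (m - 1) * sqrt (1 - (t + d)\<^sup>2) ^ (m - 1) / unit_ball_vol m"
    by (simp add: pos_le_divide_eq)
  then have "ennreal (d * sqrt (m / (2 * pi)) * sqrt (1 - (t + d)\<^sup>2) ^ (m - 1))
      \<le> ennreal (d * unit_ball_vol (m - 1) * sqrt (1 - (t + d)\<^sup>2) ^ (m - 1) / unit_ball_vol m)"
    by (rule ennreal_leI)
  also have "\<dots> = ennreal (d * unit_ball_vol (m - 1) * sqrt (1 - (t + d)\<^sup>2) ^ (m - 1)) / ennreal (unit_ball_vol m)"
  proof -
    have "(t + d)\<^sup>2 \<le> 1"
      using td by (simp add: abs_square_le_1)
    then show ?thesis
      using td by (intro divide_ennreal [symmetric]) auto
  qed
  also have "\<dots> \<le> emeasure ?L ?W / ennreal (unit_ball_vol m)"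
    using emeasure_ball_cap_ge [of "{..<m}" v t d] m v td
    by (intro divide_right_mono_ennreal) (auto simp: lessThan_empty_iff)
  also have "\<dots> \<le> emeasure ?L (unit_ball m \<inter> (proj -` ?H \<inter> space ?L)) / emeasure ?L (unit_ball m)"
    unfolding emeasure_unit_ball
    using sub by (intro divide_right_mono_ennreal emeasure_mono) auto
  also have "\<dots> = emeasure (uniform_measure ?L (unit_ball m)) (proj -` ?H \<inter> space ?L)"
    by (rule emeasure_uniform_measure [symmetric]) measurable
  also have "\<dots> = emeasure (uniform_sphere m) ?H"
    unfolding uniform_sphere_def proj_def [symmetric] by (subst emeasure_distr) auto
  finally show ?thesis .
qed

text \<open>
  By \<open>i\<^sup>2 = k\<^sup>2 = -1\<close> and \<open>j\<^sup>2 = 1\<close>, the real part is the Euclidean inner product of the stacked vectors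
  with the signs of the \<open>i\<close>- and \<open>k\<close>-blocks, which have odd numbers, reversed.
\<close>
lemma cq_Re_dot_eq_sum_stack:
  "cq_Re (cq_dot n x y) = (\<Sum>m<4 * n. (- 1) ^ (m div n) * cq_stack n x m * cq_stack n y m)"
proof -
  let ?f = "\<lambda>m. (- 1) ^ (m div n) * cq_stack n x m * cq_stack n y m"
  let ?c = "[cq0, cq1, cq2, cq3]"
  have "(\<Sum>m<4 * n. ?f m) = (\<Sum>b<4. \<Sum>m=b * n..<b * n + n. ?f m)"
    by (rule sum.nat_group [symmetric])
  also have "\<dots> = (\<Sum>b<4. \<Sum>i<n. (- 1) ^ b * (?c ! b) (x i) * (?c ! b) (y i))"
  proof (rule sum.cong [OF refl])
    fix b :: nat assume "b \<in> {..<4}"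
    then have "Suc b * n \<le> 4 * n"
      by (intro mult_le_mono1) auto
    then have "b * n + i < 4 * n" if "i < n" for i
      using that unfolding mult_Suc by linarith
    then show "(\<Sum>m=b * n..<b * n + n. ?f m) = (\<Sum>i<n. (- 1) ^ b * (?c ! b) (x i) * (?c ! b) (y i))"
      by (subst sum.atLeastLessThan_shift_0)
        (auto simp: cq_stack_def lessThan_atLeast0 div_add1_eq intro!: sum.cong)
  qed
  also have "\<dots> = (\<Sum>i<n. cq0 (x i * y i))"
    by (simp add: numeral_eq_Suc sum.distrib [symmetric] times_cquat_def)
  also have "\<dots> = cq0 (cq_dot n x y)"
    unfolding cq_dot_def by (induction n) (simp_all add: zero_cquat_def plus_cquat_def)
  finally show ?thesis ..
qed

text \<open>
  The volume of a cylinder of height \<open>d\<close> inside the cap at height \<open>t\<close>, as a proportion of the unit ball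
  of \<open>\<real>\<^sup>4\<^sup>n\<close>, is at least this: \<open>d\<close> and the square root come from the height and from the ratio of
  the ball volumes in dimensions \<open>4 * n - 1\<close> and \<open>4 * n\<close>, and the power is that of the radius
  \<open>sqrt (1 - (t + d)\<^sup>2)\<close> of the base, with its exponent \<open>4 * n - 1\<close> rounded up to \<open>4 * n\<close>.
\<close>
definition cap_bound :: "nat \<Rightarrow> real \<Rightarrow> real \<Rightarrow> real" where
  "cap_bound n t d = d * sqrt (2 * n / pi) * (1 - (t + d)\<^sup>2) ^ (2 * n)"

text \<open>
  Given \<open>a\<close>, the event says that \<open>\<xi>\<close> lies in the cap around \<open>a\<close> with some signs reversed, a unit
  vector almost surely.  The bound for a cap does not depend on its centre, so it survives averaging
  over \<open>a\<close>.
\<close>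
lemma prob_Re_dot_ge:
  fixes t d :: real
  assumes "prob_space M" and n: "n > 0" and \<xi>: "uniform_on_cq_sphere M n \<xi>"
    and a: "uniform_on_cq_sphere M n a"
    and indep: "prob_space.indep_var M (cquat_vec n) a (cquat_vec n) \<xi>"
    and td: "t > 0" "d \<ge> 0" "t + d < 1"
  shows "cap_bound n t d
    \<le> measure M {\<omega> \<in> space M. t \<le> cq_Re (cq_dot n (a \<omega>) (\<xi> \<omega>))}"
proof -
  interpret prob_space M by fact
  let ?R = "real_vec (4 * n)" and ?D = "uniform_sphere (4 * n)"
  interpret D: prob_space ?D
    by (rule prob_space_uniform_sphere)
  have sets_D [measurable_cong]: "sets ?D = sets ?R"
    by (simp add: uniform_sphere_def)
  define X A where "X = cq_stack n \<circ> \<xi>" and "A = cq_stack n \<circ> a"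
  have X [measurable]: "X \<in> M \<rightarrow>\<^sub>M ?R" and A [measurable]: "A \<in> M \<rightarrow>\<^sub>M ?R"
    using a \<xi> unfolding X_def A_def uniform_on_cq_sphere_def
    by (auto intro!: measurable_comp [OF _ measurable_cq_stack])
  have dist: "distr M ?R X = ?D" "distr M ?R A = ?D"
    using a \<xi> unfolding X_def A_def uniform_on_cq_sphere_def by (simp_all add: comp_def)
  have "indep_var ?R A ?R X"
    unfolding A_def X_def using indep by (rule indep_var_compose) measurable
  then have joint: "distr M (?R \<Otimes>\<^sub>M ?R) (\<lambda>\<omega>. (A \<omega>, X \<omega>)) = ?D \<Otimes>\<^sub>M ?D"
    unfolding indep_var_distribution_eq by (simp add: dist)
  define s :: "nat \<Rightarrow> real" where "s m = (- 1) ^ (m div n)" for m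
  define p where "p = cap_bound n t d"
  have "(t + d)\<^sup>2 < 1"
    using td by (simp add: abs_square_less_1)
  then have q: "0 \<le> 1 - (t + d)\<^sup>2" "1 - (t + d)\<^sup>2 \<le> 1"
    by auto
  define S where "S = {z \<in> space (?R \<Otimes>\<^sub>M ?R). t \<le> (\<Sum>m<4 * n. s m * fst z m * snd z m)}"
  have S [measurable]: "S \<in> sets (?R \<Otimes>\<^sub>M ?R)"
    unfolding S_def real_vec_def by measurable
  have "p = d * sqrt (real (4 * n) / (2 * pi)) * sqrt (1 - (t + d)\<^sup>2) ^ (4 * n)"
    using q power_mult [of "sqrt (1 - (t + d)\<^sup>2)" 2 "2 * n"] by (simp add: p_def cap_bound_def)
  also have "\<dots> \<le> d * sqrt (real (4 * n) / (2 * pi)) * sqrt (1 - (t + d)\<^sup>2) ^ (4 * n - 1)"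
    using q td by (intro mult_left_mono power_decreasing) auto
  finally have p: "ennreal p \<le> ennreal (d * sqrt (real (4 * n) / (2 * pi)) * sqrt (1 - (t + d)\<^sup>2) ^ (4 * n - 1))"
    by (rule ennreal_leI)
  have "ennreal p = (\<integral>\<^sup>+x. ennreal p \<partial>?D)"
    by (simp add: D.emeasure_space_1)
  also have "\<dots> \<le> (\<integral>\<^sup>+x. emeasure ?D (Pair x -` S) \<partial>?D)"
  proof (rule nn_integral_mono_AE)
    have "AE x in ?D. L2_set x {..<4 * n} = 1"
      using n by (intro AE_uniform_sphere) simp
    then show "AE x in ?D. ennreal p \<le> emeasure ?D (Pair x -` S)"
    proof (rule AE_mp, intro AE_I2 impI)
      fix x assume x: "x \<in> space ?D" "L2_set x {..<4 * n} = 1"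
      have "(\<Sum>m<4 * n. (s m * x m)\<^sup>2) = 1"
        using x(2) by (simp add: s_def power_mult_distrib power_mult [symmetric] L2_set_def)
      from uniform_sphere_halfspace_ge [OF _ this td]
      have "ennreal p \<le> emeasure ?D {y \<in> space ?R. t \<le> (\<Sum>m<4 * n. s m * x m * y m)}"
        using p n by (intro order_trans [OF p]) simp
      also have "{y \<in> space ?R. t \<le> (\<Sum>m<4 * n. s m * x m * y m)} = Pair x -` S"
        using x sets_eq_imp_space_eq [OF sets_D] by (auto simp: S_def space_pair_measure)
      finally show "ennreal p \<le> emeasure ?D (Pair x -` S)" .
    qed
  qed
  also have "\<dots> = emeasure (?D \<Otimes>\<^sub>M ?D) S"
    by (rule D.emeasure_pair_measure_alt [symmetric]) measurable
  also have "\<dots> = emeasure M ((\<lambda>\<omega>. (A \<omega>, X \<omega>)) -` S \<inter> space M)"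
    unfolding joint [symmetric] by (rule emeasure_distr) measurable
  also have "(\<lambda>\<omega>. (A \<omega>, X \<omega>)) -` S \<inter> space M
      = {\<omega> \<in> space M. t \<le> cq_Re (cq_dot n (a \<omega>) (\<xi> \<omega>))}"
  proof -
    have "cq_Re (cq_dot n (a \<omega>) (\<xi> \<omega>)) = (\<Sum>m<4 * n. s m * A \<omega> m * X \<omega> m)" for \<omega>
      by (simp add: cq_Re_dot_eq_sum_stack s_def A_def X_def)
    moreover have "A \<omega> \<in> space ?R" "X \<omega> \<in> space ?R" if "\<omega> \<in> space M" for \<omega>
      using that measurable_space [OF X] measurable_space [OF A] by auto
    ultimately show ?thesis
      by (auto simp: S_def space_pair_measure)
  qed
  finally show ?thesis
    by (simp add: p_def emeasure_eq_measure)
qed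

section \<open>A bound uniform in the dimension\<close>

lemma finite_uniform_lower_bound:
  fixes P :: "'a \<Rightarrow> real \<Rightarrow> bool"
  assumes "finite S" "\<And>n. n \<in> S \<Longrightarrow> \<exists>c>0. P n c"
    and "\<And>n b c. P n c \<Longrightarrow> b \<le> c \<Longrightarrow> P n b"
  shows "\<exists>c>0. \<forall>n\<in>S. P n c"
proof -
  obtain f where f: "f n > 0 \<and> P n (f n)" if "n \<in> S" for n
    using assms(2) by metis
  define c where "c = Min (insert 1 (f ` S))"
  have "c > 0"
    using f \<open>finite S\<close> by (auto simp: c_def)
  moreover have "c \<le> f n" if "n \<in> S" for n
    using that \<open>finite S\<close> by (auto simp: c_def)
  ultimately show ?thesis
    using f assms(3) by blast
qed

lemma one_minus_ge_exp:
  fixes x :: real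
  assumes "0 \<le> x" "x \<le> 1 / 2"
  shows "exp (- (2 * x)) \<le> 1 - x"
proof -
  have "x * (2 * x) \<le> x * 1"
    using assms by (intro mult_left_mono) auto
  then have "- (2 * x) \<le> ln (1 - x)"
    using ln_one_minus_pos_lower_bound [OF assms] by (simp add: power2_eq_square)
  then show ?thesis
    using assms by (simp add: ln_ge_iff)
qed

text \<open>
  The fraction \<open>1 / 20\<close> is chosen so that \<open>4 * (21 / 20)\<^sup>2 = 4.41\<close> stays below \<open>4.5\<close>: the estimate
  \<open>1 - x \<ge> exp (- 2 * x)\<close> with \<open>x = (21 / 20)\<^sup>2 * t\<^sup>2\<close> bounds the power in \<open>cap_bound\<close> below by
  \<open>n powr (- 4.41 * \<gamma>)\<close>.  It needs \<open>x \<le> 1 / 2\<close>, which is what the upper bound \<open>9 / 20\<close> on \<open>t\<^sup>2\<close> is for.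
\<close>
lemma cap_bound_asymptotic:
  fixes \<gamma> :: real
  assumes \<gamma>: "\<gamma> > 0" and n: "n \<ge> 2" and small: "\<gamma> * ln n / n \<le> 9 / 20"
  defines "t \<equiv> sqrt (\<gamma> * ln n / n)"
  shows "t + t / 20 < 1"
    and "sqrt (2 * \<gamma> / pi) * ln 2 / 20 / (n powr (4.5 * \<gamma>) * sqrt (ln n)) \<le> cap_bound n t (t / 20)"
proof -
  define x where "x = (t + t / 20)\<^sup>2"
  have L: "ln 2 \<le> ln (real n)" "ln (real n) > 0"
    using n by auto
  have t2: "t\<^sup>2 = \<gamma> * ln n / n" "t \<ge> 0"
    using \<gamma> L n by (auto simp: t_def)
  have x_eq: "x = 441 / 400 * t\<^sup>2"
    by (simp add: x_def power2_eq_square)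
  have x: "0 \<le> x" "x \<le> 1 / 2"
    using small zero_le_power2 [of t] unfolding x_eq t2(1) by linarith+
  then have "(t + t / 20)\<^sup>2 < 1\<^sup>2"
    by (simp add: x_def)
  then show "t + t / 20 < 1"
    by (rule power2_less_imp_less) simp
  have nx: "n * x = 441 / 400 * \<gamma> * ln n"
    using n by (simp add: x_eq t2(1))
  have "n powr (- (4.5 * \<gamma>)) \<le> exp (- (2 * x)) ^ (2 * n)"
  proof -
    have "4 * (n * x) \<le> 4.5 * \<gamma> * ln n"
      using \<gamma> L unfolding nx by simp
    moreover have "exp (- (2 * x)) ^ (2 * n) = exp (- (4 * (n * x)))"
      by (simp add: exp_of_nat_mult [symmetric])
    ultimately show ?thesis
      using n by (simp add: powr_def)
  qed
  also have "\<dots> \<le> (1 - x) ^ (2 * n)"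
    using x by (intro power_mono one_minus_ge_exp) auto
  finally have decay: "n powr (- (4.5 * \<gamma>)) \<le> (1 - x) ^ (2 * n)" .
  \<comment> \<open>The height gives a factor \<open>sqrt (ln n)\<close>, which is at least a constant multiple of \<open>1 / sqrt (ln n)\<close>.\<close>
  have "ln 2 / sqrt (ln n) \<le> ln n / sqrt (ln n)"
    using L by (intro divide_right_mono) auto
  also have "\<dots> = sqrt (ln n)"
    using L by (simp add: real_div_sqrt)
  finally have "sqrt (2 * \<gamma> / pi) / 20 * (ln 2 / sqrt (ln n)) \<le> sqrt (2 * \<gamma> / pi) / 20 * sqrt (ln n)"
    using \<gamma> by (intro mult_left_mono) auto
  also have "\<dots> = t / 20 * sqrt (2 * n / pi)"
    using n by (simp add: t_def real_sqrt_mult [symmetric])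
  finally have height: "sqrt (2 * \<gamma> / pi) / 20 * (ln 2 / sqrt (ln n)) \<le> t / 20 * sqrt (2 * n / pi)" .
  have "sqrt (2 * \<gamma> / pi) * ln 2 / 20 / (n powr (4.5 * \<gamma>) * sqrt (ln n))
      = sqrt (2 * \<gamma> / pi) / 20 * (ln 2 / sqrt (ln n)) * n powr (- (4.5 * \<gamma>))"
    by (simp add: powr_minus_divide)
  also have "\<dots> \<le> t / 20 * sqrt (2 * n / pi) * (1 - x) ^ (2 * n)"
    using t2(2) by (intro mult_mono [OF height decay]) auto
  also have "\<dots> = cap_bound n t (t / 20)"
    unfolding cap_bound_def x_def by simp
  finally show "sqrt (2 * \<gamma> / pi) * ln 2 / 20 / (n powr (4.5 * \<gamma>) * sqrt (ln n)) \<le> cap_bound n t (t / 20)" .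
qed

text \<open>
  The asymptotic bound covers all but finitely many \<open>n\<close>.  For each of the others \<open>\<gamma> * ln n < n\<close> says that
  the height of the cap is below \<open>1\<close>, so some cylinder of positive volume fits and any positive number
  will do.
\<close>
lemma cap_bound_ge:
  fixes \<gamma> :: real
  assumes \<gamma>: "\<gamma> > 0"
  shows "\<exists>c>0. \<forall>n\<ge>2. \<gamma> * ln (real n) < real n \<longrightarrow>
    (\<exists>d\<ge>0. sqrt (\<gamma> * ln n / n) + d < 1 \<and>
      c / (n powr (4.5 * \<gamma>) * sqrt (ln n)) \<le> cap_bound n (sqrt (\<gamma> * ln n / n)) d)"
proof -
  define t where "t n = sqrt (\<gamma> * ln (real n) / real n)" for n
  define w where "w n = real n powr (4.5 * \<gamma>) * sqrt (ln (real n))" for n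
  define P where "P n c \<longleftrightarrow> (\<exists>d\<ge>0. t n + d < 1 \<and> c / w n \<le> cap_bound n (t n) d)" for n c
  have w: "w n > 0" if "n \<ge> 2" for n
    using that by (auto simp: w_def)
  have mono: "P n b" if "P n c" "b \<le> c" for n b c
  proof -
    have "w n \<ge> 0"
      by (cases "n = 0") (auto simp: w_def)
    then have "b / w n \<le> c / w n"
      using that(2) by (rule divide_right_mono [rotated])
    then show ?thesis
      using that(1) unfolding P_def by (meson order_trans)
  qed
  have "(\<lambda>n. \<gamma> * (ln (real n) / real n)) \<longlonglongrightarrow> \<gamma> * 0"
    by (intro tendsto_intros lim_ln_over_n)
  then have "eventually (\<lambda>n. \<gamma> * (ln (real n) / real n) < 9 / 20) sequentially"
    by (rule order_tendstoD) simp
  then obtain N where N: "\<gamma> * ln (real n) / real n \<le> 9 / 20" if "n \<ge> N" for n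
    by (force simp: eventually_sequentially)
  define c1 where "c1 = sqrt (2 * \<gamma> / pi) * ln 2 / 20"
  have c1: "c1 > 0"
    using \<gamma> by (simp add: c1_def)
  have large: "P n c1" if "n \<ge> 2" "n \<ge> N" for n
  proof -
    have "t n \<ge> 0"
      using that \<gamma> by (simp add: t_def)
    then show ?thesis
      using cap_bound_asymptotic [OF \<gamma> that(1) N [OF that(2)]]
      unfolding P_def t_def w_def c1_def by (intro exI [of _ "t n / 20"]) (simp add: t_def)
  qed
  define S where "S = {n. n \<ge> 2 \<and> n < N \<and> \<gamma> * ln (real n) < real n}"
  have ex: "\<exists>c>0. P n c" if n: "n \<in> S" for n
  proof -
    have "\<gamma> * ln (real n) / real n < 1"
      using n by (simp add: S_def)
    then have t: "t n < 1" "t n \<ge> 0"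
      using n \<gamma> by (auto simp: t_def S_def)
    define d where "d = (1 - t n) / 2"
    have d: "d > 0" "t n + d < 1"
      using t by (auto simp: d_def field_simps)
    then have "(t n + d)\<^sup>2 < 1"
      using t by (simp add: abs_square_less_1)
    then have "cap_bound n (t n) d > 0"
      using d n by (auto simp: cap_bound_def S_def)
    moreover have "w n > 0"
      using w n by (simp add: S_def)
    ultimately have "cap_bound n (t n) d * w n > 0" "cap_bound n (t n) d * w n / w n = cap_bound n (t n) d"
      by simp_all
    moreover from this(2) have "P n (cap_bound n (t n) d * w n)"
      using d unfolding P_def by (intro exI [of _ d]) simp
    ultimately show ?thesis
      by blast
  qed
  have "finite S"
    by (rule finite_subset [of _ "{..<N}"]) (auto simp: S_def)
  then have "\<exists>c>0. \<forall>n\<in>S. P n c"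
  proof (rule finite_uniform_lower_bound [of S P])
    show "\<exists>c>0. P n c" if "n \<in> S" for n
      using that by (rule ex)
    show "P n b" if "P n c" "b \<le> c" for n b c
      using that by (rule mono)
  qed
  then obtain c2 where c2: "c2 > 0" "\<forall>n\<in>S. P n c2"
    by blast
  have both: "P n (min c1 c2)" if "n \<ge> 2" "\<gamma> * ln (real n) < real n" for n
  proof (cases "n \<ge> N")
    case True
    then have "P n c1"
      using large that by simp
    then show ?thesis
      by (rule mono) simp
  next
    case False
    then have "P n c2"
      using c2(2) that by (simp add: S_def)
    then show ?thesis
      by (rule mono) simp
  qed
  have "min c1 c2 > 0"
    using c1 c2(1) by simp
  moreover have "\<forall>n\<ge>2. \<gamma> * ln (real n) < real n \<longrightarrow> P n (min c1 c2)"
    using both by simp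
  ultimately show ?thesis
    unfolding P_def t_def w_def by (intro exI [of _ "min c1 c2"] conjI)
qed

theorem theorem3p1:
  fixes \<gamma> :: real
  assumes "\<gamma> > 0"
  shows "\<exists>c::real. c > 0 \<and>
    (\<forall>n::nat. n \<ge> 2 \<longrightarrow> \<gamma> * ln (real n) < real n \<longrightarrow>
      (\<forall>(M :: 'w measure) \<xi> a.
        prob_space M \<longrightarrow>
        uniform_on_cq_sphere M n \<xi> \<longrightarrow>
        uniform_on_cq_sphere M n a \<longrightarrow>
        prob_space.indep_var M (cquat_vec n) a (cquat_vec n) \<xi> \<longrightarrow>
        measure M {\<omega> \<in> space M. cq_Re (cq_dot n (a \<omega>) (\<xi> \<omega>)) \<ge> sqrt (\<gamma> * ln (real n) / real n)}
          \<ge> c / (real n powr (4.5 * \<gamma>) * sqrt (ln (real n)))))"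
proof -
  obtain c where "c > 0" and c: "\<And>n. n \<ge> 2 \<Longrightarrow> \<gamma> * ln (real n) < real n \<Longrightarrow>
      \<exists>d\<ge>0. sqrt (\<gamma> * ln n / n) + d < 1 \<and>
        c / (n powr (4.5 * \<gamma>) * sqrt (ln n)) \<le> cap_bound n (sqrt (\<gamma> * ln n / n)) d"
    using cap_bound_ge [OF assms] by blast
  show ?thesis
  proof (intro exI [of _ c] conjI allI impI)
    show "c > 0"
      by fact
  next
    fix n :: nat and M :: "'w measure" and \<xi> a
    assume n: "n \<ge> 2" "\<gamma> * ln (real n) < real n"
      and M: "prob_space M" "uniform_on_cq_sphere M n \<xi>" "uniform_on_cq_sphere M n a"
        "prob_space.indep_var M (cquat_vec n) a (cquat_vec n) \<xi>"
    define t where "t = sqrt (\<gamma> * ln (real n) / real n)"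
    have "n > 0" "t > 0"
      using assms n by (auto simp: t_def)
    obtain d where d: "d \<ge> 0" "t + d < 1"
      and bound: "c / (n powr (4.5 * \<gamma>) * sqrt (ln n)) \<le> cap_bound n t d"
      using c [OF n] unfolding t_def by blast
    note bound
    also have "cap_bound n t d
        \<le> measure M {\<omega> \<in> space M. t \<le> cq_Re (cq_dot n (a \<omega>) (\<xi> \<omega>))}"
      using M(1) \<open>n > 0\<close> M(2-4) \<open>t > 0\<close> d by (rule prob_Re_dot_ge)
    finally show "measure M {\<omega> \<in> space M.
          cq_Re (cq_dot n (a \<omega>) (\<xi> \<omega>)) \<ge> sqrt (\<gamma> * ln (real n) / real n)}
        \<ge> c / (real n powr (4.5 * \<gamma>) * sqrt (ln (real n)))"
      by (simp add: t_def)
  qed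
qed

end
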